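(* Let $\mathbb F\in\{\mathbb R,\mathbb C\}$, let $X,Y$ be $n\times m$ matrices over $\mathbb F$, let $X^{+}$ be the Moore--Penrose inverse of $X$, and let $g_0=YX^{+}$. For every $n\times n$ matrix $g$ over $\mathbb F$, $$\|gX-Y\|_F^{2}=\|(g-g_0)X\|_F^{2}+\|g_0X-Y\|_F^{2}.$$
   Context: $\|A\|_F=\sqrt{\mathrm{Re}\,\mathrm{tr}(A^\dagger A)}$ is the Frobenius norm, where $A^\dagger$ is the conjugate transpose. The Moore--Penrose inverse $X^{+}$ is the unique $m\times n$ matrix with $XX^{+}X=X$, $X^{+}XX^{+}=X^{+}$, $(XX^{+})^\dagger=XX^{+}$, $(X^{+}X)^\dagger=X^{+}X$. *)

theory Defs
  imports "HOL-Analysis.Analysis"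
begin

text \<open>
  The class below only serves to write each matrix notion once for both scalar fields, real and
  complex numbers: it provides conjugation and the real part, which on the real numbers are both
  the identity. It is instantiated for these two types and no others.
\<close>

class real_or_complex = real_normed_field +
  fixes cj :: "'a \<Rightarrow> 'a"
    and re_part :: "'a \<Rightarrow> real"
  assumes cj_add: "cj (a + b) = cj a + cj b"
    and cj_mult: "cj (a * b) = cj a * cj b"
    and cj_cj: "cj (cj a) = a"
    and cj_scaleR_one: "cj (r *\<^sub>R 1) = r *\<^sub>R 1"
    and cj_mult_self: "cj a * a = (norm a)\<^sup>2 *\<^sub>R 1"
    and add_cj: "a + cj a = (2 * re_part a) *\<^sub>R 1"

instantiation real :: real_or_complex
begin

definition cj_real :: "real \<Rightarrow> real"
  where "cj_real x = x"

definition re_part_real :: "real \<Rightarrow> real"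
  where "re_part_real x = x"

instance
  by standard (simp_all add: cj_real_def re_part_real_def power2_eq_square)

end

instantiation complex :: real_or_complex
begin

definition cj_complex :: "complex \<Rightarrow> complex"
  where "cj_complex z = cnj z"

definition re_part_complex :: "complex \<Rightarrow> real"
  where "re_part_complex z = Re z"

instance
proof
  fix a :: complex
  show "cj a * a = (norm a)\<^sup>2 *\<^sub>R 1"
    by (metis cj_complex_def complex_norm_square mult.commute of_real_def)
  show "a + cj a = (2 * re_part a) *\<^sub>R 1"
    by (simp add: cj_complex_def re_part_complex_def complex_eq_iff)
qed (simp_all add: cj_complex_def)

end

text \<open>A matrix with \<open>n\<close> rows and \<open>m\<close> columns has type \<open>'a^'m^'n\<close>.\<close>

definition ctranspose :: "'a::real_or_complex^'m^'n \<Rightarrow> 'a^'n^'m"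
  where "ctranspose A = (\<chi> i j. cj (A $ j $ i))"

definition frobenius_norm :: "'a::real_or_complex^'m^'n \<Rightarrow> real"
  where "frobenius_norm A = sqrt (re_part (trace (ctranspose A ** A)))"

definition is_pinv :: "'a::real_or_complex^'m^'n \<Rightarrow> 'a^'n^'m \<Rightarrow> bool"
  where "is_pinv X P \<longleftrightarrow>
    X ** P ** X = X \<and> P ** X ** P = P \<and>
    ctranspose (X ** P) = X ** P \<and> ctranspose (P ** X) = P ** X"

definition pinv :: "'a::real_or_complex^'m^'n \<Rightarrow> 'a^'n^'m"
  where "pinv X = (THE P. is_pinv X P)"

end

theory Submission
  imports Defs
begin

text \<open>
  The identity is Pythagoras' theorem. The residual \<open>g ** X - Y\<close> splits as
  \<open>(g - g\<^sub>0) ** X + (g\<^sub>0 ** X - Y)\<close>, and the rows of the second summand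
  \<open>Y ** (pinv X ** X) - Y\<close> are orthogonal to the row space of \<open>X\<close>, because
  \<open>pinv X ** X\<close> is the orthogonal projection onto that space. The
  rows of the first summand lie in that row space, so the cross terms vanish
  (\<open>frobenius_norm_add_orthogonal\<close>).

  This uses that \<open>pinv X\<close> satisfies the Penrose equations, that is, that they have exactly one
  solution (\<open>is_pinv_pinv\<close>). Existence is obtained without a singular value decomposition.
  Linear algebra over any field gives a matrix \<open>G\<close> with \<open>A ** G ** A = A\<close>. Taken for the Gram
  matrix of \<open>X\<close>, and cancelling a conjugate transpose by definiteness of the Frobenius norm, it
  makes \<open>X ** G ** ctranspose X\<close> the orthogonal projection onto the column space of \<open>X\<close>. The same
  construction for \<open>ctranspose X\<close> gives the projection onto the row space, and the two combine to
  the pseudoinverse.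

  Everything is proved over the class of scalars that covers both fields at once.
\<close>

section \<open>Matrix arithmetic and conjugate transposes\<close>

lemma matrix_add_rdistrib:
  fixes A B :: "'a::semiring_1^'m^'n"
  shows "(A + B) ** C = A ** C + B ** C"
  by (vector matrix_matrix_mult_def sum.distrib[symmetric] field_simps)

lemma matrix_diff_ldistrib:
  fixes B C :: "'a::ring_1^'m^'n"
  shows "A ** (B - C) = A ** B - A ** C"
  by (vector matrix_matrix_mult_def sum_subtractf[symmetric] right_diff_distrib)

lemma matrix_diff_rdistrib:
  fixes A B :: "'a::ring_1^'m^'n"
  shows "(A - B) ** C = A ** C - B ** C"
  by (vector matrix_matrix_mult_def sum_subtractf[symmetric] left_diff_distrib)

lemma matrix_mult_zero_right:
  fixes A :: "'a::semiring_1^'m^'n"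
  shows "A ** 0 = 0"
  by (vector matrix_matrix_mult_def)

lemma cj_zero: "cj (0::'a::real_or_complex) = 0"
  using cj_add[of "0::'a" 0] by simp

lemma cj_sum: "cj (sum f S) = (\<Sum>i\<in>S. cj (f i :: 'a::real_or_complex))"
  by (induction S rule: infinite_finite_induct) (simp_all add: cj_zero cj_add)

lemma ctranspose_ctranspose: "ctranspose (ctranspose A) = A"
  by (simp add: ctranspose_def cj_cj vec_eq_iff)

lemma ctranspose_mult: "ctranspose (A ** B) = ctranspose B ** ctranspose A"
  by (simp add: ctranspose_def matrix_matrix_mult_def vec_eq_iff cj_sum cj_mult mult.commute)

lemma ctranspose_add: "ctranspose (A + B) = ctranspose A + ctranspose B"
  by (simp add: ctranspose_def vec_eq_iff cj_add)

lemma ctranspose_zero: "ctranspose 0 = 0"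
  by (simp add: ctranspose_def vec_eq_iff cj_zero)

section \<open>The Frobenius norm\<close>

lemma trace_ctranspose_mult_self_entries:
  fixes A :: "'a::real_or_complex^'m^'n"
  shows "trace (ctranspose A ** A) = of_real (\<Sum>j\<in>UNIV. \<Sum>i\<in>UNIV. (norm (A $ i $ j))\<^sup>2)"
  unfolding trace_def ctranspose_def matrix_matrix_mult_def
  by (simp only: vec_lambda_beta cj_mult_self of_real_sum of_real_def[symmetric])

lemma re_part_of_real: "re_part (of_real r :: 'a::real_or_complex) = r"
proof -
  have "(of_real (2 * r) :: 'a) = of_real (2 * re_part (of_real r :: 'a))"
    using add_cj[of "of_real r :: 'a"] cj_scaleR_one[of r, where 'a = 'a]
    by (simp add: of_real_def scaleR_add_left[symmetric])
  then show ?thesis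
    by (simp only: of_real_eq_iff)
qed

lemma frobenius_norm_squared_entries:
  fixes A :: "'a::real_or_complex^'m^'n"
  shows "(frobenius_norm A)\<^sup>2 = (\<Sum>j\<in>UNIV. \<Sum>i\<in>UNIV. (norm (A $ i $ j))\<^sup>2)"
  by (simp only: frobenius_norm_def trace_ctranspose_mult_self_entries re_part_of_real)
    (simp add: sum_nonneg)

text \<open>
  Stating the trace as a scalar, rather than its real part, lets the Pythagorean identity be read
  off from additivity of the trace.
\<close>

lemma trace_ctranspose_mult_self:
  "trace (ctranspose A ** A) = of_real ((frobenius_norm A)\<^sup>2)"
  by (simp only: trace_ctranspose_mult_self_entries frobenius_norm_squared_entries)

lemma ctranspose_mult_self_eq_0_imp_eq_0:
  fixes A :: "'a::real_or_complex^'m^'n"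
  assumes "ctranspose A ** A = 0"
  shows "A = 0"
proof -
  have "(of_real (\<Sum>j\<in>UNIV. \<Sum>i\<in>UNIV. (norm (A $ i $ j))\<^sup>2) :: 'a) = 0"
    by (simp only: trace_ctranspose_mult_self_entries[symmetric] assms) (simp add: trace_def)
  then have "(\<Sum>j\<in>UNIV. \<Sum>i\<in>UNIV. (norm (A $ i $ j))\<^sup>2) = 0"
    by (simp only: of_real_eq_0_iff)
  then have "\<forall>j. (\<Sum>i\<in>UNIV. (norm (A $ i $ j))\<^sup>2) = 0"
    by (subst (asm) sum_nonneg_eq_0_iff) (auto intro: sum_nonneg)
  then have "\<forall>i j. (norm (A $ i $ j))\<^sup>2 = 0"
    by (subst (asm) sum_nonneg_eq_0_iff) auto
  then show ?thesis
    by (simp add: vec_eq_iff)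
qed

text \<open>
  A matrix and its Gram matrix have the same kernel, since \<open>ctranspose D ** (ctranspose A ** A) ** D\<close>
  is the Gram matrix of \<open>A ** D\<close>.
\<close>

lemma gram_mult_eq_0_imp_mult_eq_0:
  fixes A :: "'a::real_or_complex^'m^'n" and D :: "'a^'k^'m"
  assumes "ctranspose A ** A ** D = 0"
  shows "A ** D = 0"
proof -
  have "ctranspose (A ** D) ** (A ** D) = ctranspose D ** (ctranspose A ** A ** D)"
    by (simp add: ctranspose_mult matrix_mul_assoc)
  also have "\<dots> = 0"
    by (simp only: assms matrix_mult_zero_right)
  finally show ?thesis
    by (rule ctranspose_mult_self_eq_0_imp_eq_0)
qed

text \<open>
  The hypothesis says that each row of \<open>B\<close> is orthogonal to each row of \<open>X\<close>, and the rows of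
  \<open>D ** X\<close> are linear combinations of the latter. Cyclicity of the trace brings \<open>B\<close> and
  \<open>ctranspose X\<close> together in the cross terms.
\<close>

lemma frobenius_norm_add_orthogonal:
  fixes X :: "'a::real_or_complex^'m^'k" and B :: "'a^'m^'n" and D :: "'a^'k^'n"
  assumes "B ** ctranspose X = 0"
  shows "(frobenius_norm (D ** X + B))\<^sup>2 = (frobenius_norm (D ** X))\<^sup>2 + (frobenius_norm B)\<^sup>2"
proof -
  have adj: "X ** ctranspose B = 0"
    using arg_cong[OF assms, of ctranspose]
    by (simp add: ctranspose_mult ctranspose_ctranspose ctranspose_zero)
  have "trace (ctranspose (D ** X) ** B) = trace (ctranspose D ** (B ** ctranspose X))"
    using trace_mul_sym[of "ctranspose X" "ctranspose D ** B"]
    by (simp add: ctranspose_mult matrix_mul_assoc)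
  then have cross1: "trace (ctranspose (D ** X) ** B) = 0"
    by (simp add: assms matrix_mult_zero_right trace_def)
  have "trace (ctranspose B ** (D ** X)) = trace (D ** (X ** ctranspose B))"
    using trace_mul_sym[of "ctranspose B" "D ** X"] by (simp add: matrix_mul_assoc)
  then have cross2: "trace (ctranspose B ** (D ** X)) = 0"
    by (simp add: adj matrix_mult_zero_right trace_def)
  have "trace (ctranspose (D ** X + B) ** (D ** X + B))
      = trace (ctranspose (D ** X) ** (D ** X)) + trace (ctranspose B ** B)"
    by (simp add: ctranspose_add matrix_add_ldistrib matrix_add_rdistrib trace_add cross1 cross2)
  then have "(of_real ((frobenius_norm (D ** X + B))\<^sup>2) :: 'a)
      = of_real ((frobenius_norm (D ** X))\<^sup>2 + (frobenius_norm B)\<^sup>2)"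
    by (simp only: trace_ctranspose_mult_self of_real_add)
  then show ?thesis
    by (simp only: of_real_eq_iff)
qed

section \<open>The Moore--Penrose inverse\<close>

text \<open>
  A linear map has a linear right inverse on its range; \<open>G\<close> is the matrix of one.
\<close>

lemma exists_generalized_inverse:
  fixes A :: "'a::field^'m^'n"
  shows "\<exists>G :: 'a^'n^'m. A ** G ** A = A"
proof -
  obtain g where lin: "Vector_Spaces.linear (*s) (*s) g" and inv: "\<And>x. A *v (g (A *v x)) = A *v x"
    using vec.linear_exists_right_inverse_on[OF matrix_vector_mul_linear_gen[of A] vec.subspace_UNIV]
    by blast
  have "A ** matrix g ** A = A"
    unfolding matrix_eq
    by (simp add: matrix_vector_mul_assoc[symmetric] matrix_works[OF lin] inv)
  then show ?thesis
    by blast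
qed

text \<open>
  The matrix \<open>X ** G ** ctranspose X\<close> is the orthogonal projection onto the column space of \<open>X\<close>;
  \<open>G\<close> is a generalized inverse of the Gram matrix of \<open>X\<close>.
\<close>

lemma exists_column_space_projection:
  fixes X :: "'a::real_or_complex^'m^'n"
  shows "\<exists>G. X ** G ** ctranspose X ** X = X \<and>
    ctranspose (X ** G ** ctranspose X) = X ** G ** ctranspose X"
proof -
  obtain G where G: "(ctranspose X ** X) ** G ** (ctranspose X ** X) = ctranspose X ** X"
    using exists_generalized_inverse by blast
  define E where "E = X ** G ** ctranspose X"
  have "ctranspose X ** X ** (G ** (ctranspose X ** X) - mat 1) = 0"
    using G by (simp add: matrix_diff_ldistrib matrix_mul_assoc)
  then have "X ** (G ** (ctranspose X ** X) - mat 1) = 0"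
    by (rule gram_mult_eq_0_imp_mult_eq_0)
  then have fix_X: "E ** X = X"
    by (simp add: E_def matrix_diff_ldistrib matrix_mul_assoc)
  (* As E fixes X, it equals E times its own conjugate transpose, which is Hermitian
     even if G is not. *)
  have "E = X ** G ** ctranspose (E ** X)"
    by (simp only: fix_X) (simp only: E_def)
  also have "\<dots> = E ** ctranspose E"
    by (simp add: ctranspose_mult E_def matrix_mul_assoc)
  finally have "ctranspose E = E"
    by (metis ctranspose_mult ctranspose_ctranspose)
  with fix_X show ?thesis
    unfolding E_def by blast
qed

text \<open>
  With \<open>E = X ** G ** ctranspose X\<close> and \<open>F = ctranspose X ** H ** X\<close> the projections onto the
  column space and the row space of \<open>X\<close>, the matrix \<open>P = F ** G ** ctranspose X\<close>, which is also
  \<open>ctranspose X ** H ** E\<close>, satisfies \<open>X ** P = E\<close> and \<open>P ** X = F\<close>.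
\<close>

lemma exists_is_pinv:
  fixes X :: "'a::real_or_complex^'m^'n"
  shows "\<exists>P. is_pinv X P"
proof -
  obtain G where EX: "X ** G ** ctranspose X ** X = X"
    and E_herm: "ctranspose (X ** G ** ctranspose X) = X ** G ** ctranspose X"
    using exists_column_space_projection by blast
  obtain H where FX: "ctranspose X ** H ** X ** ctranspose X = ctranspose X"
    and F_herm: "ctranspose (ctranspose X ** H ** X) = ctranspose X ** H ** X"
    using exists_column_space_projection[of "ctranspose X"] by (auto simp: ctranspose_ctranspose)
  define P where "P = ctranspose X ** H ** X ** G ** ctranspose X"
  have "X ** (ctranspose X ** H ** X) = ctranspose (ctranspose X ** H ** X ** ctranspose X)"
    by (metis F_herm ctranspose_mult ctranspose_ctranspose)
  then have XF: "X ** (ctranspose X ** H ** X) = X"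
    by (simp only: FX ctranspose_ctranspose)
  have "X ** P = X ** (ctranspose X ** H ** X) ** G ** ctranspose X"
    by (simp add: P_def matrix_mul_assoc)
  then have XP: "X ** P = X ** G ** ctranspose X"
    by (simp only: XF)
  have "P ** X = ctranspose X ** H ** (X ** G ** ctranspose X ** X)"
    by (simp add: P_def matrix_mul_assoc)
  then have PX: "P ** X = ctranspose X ** H ** X"
    by (simp only: EX)
  have "P ** X ** P = ctranspose X ** H ** X ** ctranspose X ** H ** X ** G ** ctranspose X"
    unfolding PX by (simp add: P_def matrix_mul_assoc)
  then have "P ** X ** P = P"
    by (simp only: FX P_def)
  then show ?thesis
    unfolding is_pinv_def using XP PX EX E_herm F_herm by metis
qed

text \<open>
  Two solutions of the Penrose equations yield the same projections \<open>X ** P = X ** Q\<close> and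
  \<open>P ** X = Q ** X\<close>, since Hermitian idempotents with a common range coincide. Hence
  \<open>P = P ** X ** P = Q ** X ** Q = Q\<close>.
\<close>

lemma is_pinv_unique:
  fixes X :: "'a::real_or_complex^'m^'n"
  assumes P: "is_pinv X P" and Q: "is_pinv X Q"
  shows "P = Q"
proof -
  have "X ** P = (X ** Q) ** (X ** P)"
    using Q by (simp add: is_pinv_def matrix_mul_assoc)
  also have "\<dots> = ctranspose ((X ** P) ** (X ** Q))"
    using P Q by (simp only: is_pinv_def ctranspose_mult[of "X ** P" "X ** Q"])
  also have "(X ** P) ** (X ** Q) = X ** Q"
    using P by (simp add: is_pinv_def matrix_mul_assoc)
  finally have XP: "X ** P = X ** Q"
    using Q by (simp add: is_pinv_def)
  have "P ** X = (P ** X) ** (Q ** X)"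
    using Q by (metis is_pinv_def matrix_mul_assoc)
  also have "\<dots> = ctranspose ((Q ** X) ** (P ** X))"
    using P Q by (simp only: is_pinv_def ctranspose_mult[of "Q ** X" "P ** X"])
  also have "(Q ** X) ** (P ** X) = Q ** X"
    using P by (metis is_pinv_def matrix_mul_assoc)
  finally have PX: "P ** X = Q ** X"
    using Q by (simp add: is_pinv_def)
  have "P = P ** X ** P"
    using P by (simp add: is_pinv_def)
  also have "\<dots> = Q ** (X ** P)"
    by (simp only: PX matrix_mul_assoc)
  also have "\<dots> = Q ** X ** Q"
    by (simp only: XP matrix_mul_assoc)
  also have "\<dots> = Q"
    using Q by (simp add: is_pinv_def)
  finally show ?thesis .
qed

lemma is_pinv_pinv: "is_pinv X (pinv X)"
  unfolding pinv_def by (rule theI') (use exists_is_pinv is_pinv_unique in blast)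

section \<open>The Pythagorean identity for least squares\<close>

lemma pinv_mult_self_ctranspose: "pinv X ** X ** ctranspose X = ctranspose X"
proof -
  have "ctranspose (X ** pinv X ** X) = ctranspose (pinv X ** X) ** ctranspose X"
    by (simp add: ctranspose_mult matrix_mul_assoc)
  then show ?thesis
    using is_pinv_pinv[of X] by (simp add: is_pinv_def)
qed

lemma least_squares_pythagoras:
  fixes X :: "'a::real_or_complex^'m^'k" and Y :: "'a^'m^'n" and g :: "'a^'k^'n"
  shows "(frobenius_norm (g ** X - Y))\<^sup>2
    = (frobenius_norm ((g - Y ** pinv X) ** X))\<^sup>2 + (frobenius_norm (Y ** pinv X ** X - Y))\<^sup>2"
proof -
  have "(Y ** pinv X ** X - Y) ** ctranspose X = Y ** (pinv X ** X ** ctranspose X) - Y ** ctranspose X"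
    by (simp add: matrix_diff_rdistrib matrix_mul_assoc)
  then have "(Y ** pinv X ** X - Y) ** ctranspose X = 0"
    by (simp add: pinv_mult_self_ctranspose)
  moreover have "g ** X - Y = (g - Y ** pinv X) ** X + (Y ** pinv X ** X - Y)"
    by (simp add: matrix_diff_rdistrib)
  ultimately show ?thesis
    using frobenius_norm_add_orthogonal by metis
qed

theorem lemma1:
  shows "(\<forall>(X :: real^'m^'n) (Y :: real^'m^'n) (g :: real^'n^'n).
           let g0 = Y ** pinv X in
             (frobenius_norm (g ** X - Y))\<^sup>2
               = (frobenius_norm ((g - g0) ** X))\<^sup>2 + (frobenius_norm (g0 ** X - Y))\<^sup>2) \<and>
         (\<forall>(X :: complex^'m^'n) (Y :: complex^'m^'n) (g :: complex^'n^'n).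
           let g0 = Y ** pinv X in
             (frobenius_norm (g ** X - Y))\<^sup>2
               = (frobenius_norm ((g - g0) ** X))\<^sup>2 + (frobenius_norm (g0 ** X - Y))\<^sup>2)"
  unfolding Let_def by (intro conjI allI; rule least_squares_pythagoras)

end
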